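(* Let $\lambda>0$ and $s,t\in(0,1]$, and let $\Pi^{s}_{t,\lambda}$ be the $s$-free Poisson distribution of parameters $\lambda$ and $t$, i.e. the probability distribution on $\mathbb{R}$, with respect to the vacuum expectation, of the bounded self-adjoint operator $\boldsymbol{P}^{s}_{t,\lambda}=m_t+\sqrt{\lambda}\,(a_s^{\dagger}+a_s)+\lambda k_s$ on the one-mode $s$-free Fock space. Let $\{C^{s}_{t,n}(\lambda;x)\}_{n\ge 0}$ be the sequence of polynomials in $x$ determined by $$C_{t,0}^{s}(\lambda;x)=1,\qquad C_{t,1}^{s}(\lambda;x)=x-\lambda,$$ $$C_{t,n+1}^{s}(\lambda;x)=\bigl(x-(\lambda s^{n}+t^{n-1})\bigr)\,C_{t,n}^{s}(\lambda;x)-\lambda s^{n-1}\,C_{t,n-1}^{s}(\lambda;x),\qquad n\ge 1.$$ Then $\Pi^{s}_{t,\lambda}$ is the orthogonalizing probability distribution for $\{C^{s}_{t,n}(\lambda;x)\}_{n\ge0}$, that is, $$\int_{\mathbb{R}} C_{t,n}^{s}(\lambda;x)\,C_{t,m}^{s}(\lambda;x)\,d\Pi^{s}_{t,\lambda}(x)=0\qquad\text{whenever } m\neq n.$$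
   Context: One-mode $s$-free Fock space: let $\xi$ be a unit vector and let $\Omega=\xi^{\otimes 0}$ be the vacuum vector. For $0<s\le 1$, $\mathcal{F}_s$ is the Hilbert space completion of the linear span of the vectors $\xi^{\otimes n}$, $n\ge0$, with respect to the inner product determined by $(\xi^{\otimes n}\,|\,\xi^{\otimes m})_s=\delta_{m,n}\,s^{n(n-1)/2}$. Operators on $\mathcal{F}_s$ (for $s,t\in(0,1]$): the $s$-creation operator $a_s^{\dagger}\xi^{\otimes m}=\xi^{\otimes(m+1)}$ for $m\ge0$; the $s$-annihilation operator $a_s$, which is the adjoint of $a_s^\dagger$ with respect to $(\cdot|\cdot)_s$ and acts by $a_s\Omega=0$, $a_s\xi^{\otimes m}=s^{m-1}\xi^{\otimes(m-1)}$ for $m\ge1$; the scalar operator $k_s\xi^{\otimes m}=s^m\xi^{\otimes m}$ for $m\ge0$; the intermediate operator $m_t\Omega=0$, $m_t\xi^{\otimes m}=t^{m-1}\xi^{\otimes m}$ for $m\ge1$. The vacuum expectation of a bounded operator $b$ on $\mathcal{F}_s$ is $\varphi(b)=(b\,\Omega\,|\,\Omega)_s$. The distribution of a bounded self-adjoint operator $b$ with respect to $\varphi$ is the unique compactly supported probability measure $\mu$ on $\mathbb{R}$ with $\varphi(b^n)=\int_{\mathbb{R}}x^n\,d\mu(x)$ for all $n\ge0$. *)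

theory Defs
  imports "HOL-Probability.Probability" "HOL-Computational_Algebra.Polynomial"
begin

section \<open>The one-mode \<open>s\<close>-free Fock space\<close>

text \<open>
  A vector \<open>\<Sum>n. f n \<cdot> \<xi>\<^bsup>\<otimes>n\<^esup>\<close> is represented by its coefficient sequence \<open>f\<close>. The completion of
  the span of the \<open>\<xi>\<^bsup>\<otimes>n\<^esup>\<close> is the weighted \<open>\<ell>\<^sup>2\<close> space with squared norms of the basis vectors as
  weights; \<open>fock_complete\<close> and \<open>fock_dense\<close> below confirm that this is the completion.
\<close>

definition fock_weight :: "real \<Rightarrow> nat \<Rightarrow> real" where
  "fock_weight s n = s ^ (n * (n - 1) div 2)"

definition fock_space :: "real \<Rightarrow> (nat \<Rightarrow> complex) set" where
  "fock_space s = {f. summable (\<lambda>n. fock_weight s n * (cmod (f n))\<^sup>2)}"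

definition fock_inner :: "real \<Rightarrow> (nat \<Rightarrow> complex) \<Rightarrow> (nat \<Rightarrow> complex) \<Rightarrow> complex" where
  "fock_inner s f g = (\<Sum>n. of_real (fock_weight s n) * (f n * cnj (g n)))"

definition fock_norm :: "real \<Rightarrow> (nat \<Rightarrow> complex) \<Rightarrow> real" where
  "fock_norm s f = sqrt (Re (fock_inner s f f))"

definition xi :: "nat \<Rightarrow> nat \<Rightarrow> complex" where
  "xi n = (\<lambda>k. if k = n then 1 else 0)"

abbreviation vacuum :: "nat \<Rightarrow> complex" where
  "vacuum \<equiv> xi 0"


section \<open>Operators\<close>

text \<open>
  Operators are given by the action on coefficient sequences of the bounded linear extension of
  their action on the basis vectors; the latter is recovered in the lemmas \<open>creation_xi\<close>,
  \<open>annihilation_xi_0\<close>, etc.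
\<close>

definition creation :: "(nat \<Rightarrow> complex) \<Rightarrow> nat \<Rightarrow> complex" where
  "creation f = (\<lambda>n. if n = 0 then 0 else f (n - 1))"

definition annihilation :: "real \<Rightarrow> (nat \<Rightarrow> complex) \<Rightarrow> nat \<Rightarrow> complex" where
  "annihilation s f = (\<lambda>n. of_real (s ^ n) * f (n + 1))"

definition scalar_op :: "real \<Rightarrow> (nat \<Rightarrow> complex) \<Rightarrow> nat \<Rightarrow> complex" where
  "scalar_op s f = (\<lambda>n. of_real (s ^ n) * f n)"

definition intermediate_op :: "real \<Rightarrow> (nat \<Rightarrow> complex) \<Rightarrow> nat \<Rightarrow> complex" where
  "intermediate_op t f = (\<lambda>n. if n = 0 then 0 else of_real (t ^ (n - 1)) * f n)"

definition free_poisson_op ::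
    "real \<Rightarrow> real \<Rightarrow> real \<Rightarrow> (nat \<Rightarrow> complex) \<Rightarrow> nat \<Rightarrow> complex" where
  "free_poisson_op s t l f = (\<lambda>n.
     intermediate_op t f n
     + of_real (sqrt l) * (creation f n + annihilation s f n)
     + of_real l * scalar_op s f n)"

definition fock_bounded_op :: "real \<Rightarrow> ((nat \<Rightarrow> complex) \<Rightarrow> nat \<Rightarrow> complex) \<Rightarrow> bool" where
  "fock_bounded_op s b \<longleftrightarrow>
     (\<forall>f\<in>fock_space s. b f \<in> fock_space s) \<and>
     (\<forall>f\<in>fock_space s. \<forall>g\<in>fock_space s. \<forall>x y.
        b (\<lambda>n. x * f n + y * g n) = (\<lambda>n. x * b f n + y * b g n)) \<and>
     (\<exists>K. \<forall>f\<in>fock_space s. fock_norm s (b f) \<le> K * fock_norm s f)"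

definition fock_adjoint ::
    "real \<Rightarrow> ((nat \<Rightarrow> complex) \<Rightarrow> nat \<Rightarrow> complex) \<Rightarrow> ((nat \<Rightarrow> complex) \<Rightarrow> nat \<Rightarrow> complex) \<Rightarrow> bool" where
  "fock_adjoint s b c \<longleftrightarrow>
     (\<forall>f\<in>fock_space s. \<forall>g\<in>fock_space s. fock_inner s (b f) g = fock_inner s f (c g))"


section \<open>Vacuum distribution\<close>

definition vacuum_expectation :: "real \<Rightarrow> ((nat \<Rightarrow> complex) \<Rightarrow> nat \<Rightarrow> complex) \<Rightarrow> complex" where
  "vacuum_expectation s b = fock_inner s (b vacuum) vacuum"

text \<open>
  \<open>\<mu>\<close> is the distribution of the bounded self-adjoint operator \<open>b\<close>. All moments of \<open>\<mu>\<close> are finite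
  because \<open>\<mu>\<close> is concentrated on a compact set.
\<close>

definition vacuum_distribution ::
    "real \<Rightarrow> ((nat \<Rightarrow> complex) \<Rightarrow> nat \<Rightarrow> complex) \<Rightarrow> real measure \<Rightarrow> bool" where
  "vacuum_distribution s b \<mu> \<longleftrightarrow>
     prob_space \<mu> \<and> sets \<mu> = sets borel \<and>
     (\<exists>K. compact K \<and> emeasure \<mu> (- K) = 0) \<and>
     (\<forall>n. vacuum_expectation s (b ^^ n) = of_real (\<integral>x. x ^ n \<partial>\<mu>))"


section \<open>The polynomials\<close>

text \<open>The recursion for index \<open>n + 1\<close>, \<open>n \<ge> 1\<close>, is written with \<open>n = Suc k\<close>.\<close>

fun charlier_poly :: "real \<Rightarrow> real \<Rightarrow> real \<Rightarrow> nat \<Rightarrow> real poly" where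
  "charlier_poly s t l 0 = 1"
| "charlier_poly s t l (Suc 0) = [:- l, 1:]"
| "charlier_poly s t l (Suc (Suc k)) =
     [:- (l * s ^ Suc k + t ^ k), 1:] * charlier_poly s t l (Suc k)
     - smult (l * s ^ k) (charlier_poly s t l k)"


section \<open>Basic facts about the Fock space\<close>

lemma fock_weight_0 [simp]: "fock_weight s 0 = 1"
  by (simp add: fock_weight_def)

lemma fock_weight_Suc: "fock_weight s (Suc n) = s ^ n * fock_weight s n"
proof -
  have "Suc n * (Suc n - 1) div 2 = n + n * (n - 1) div 2"
  proof (cases n)
    case (Suc m)
    have "Suc n * (Suc n - 1) = 2 * n + n * (n - 1)"
      using Suc by (simp add: algebra_simps)
    then show ?thesis by simp
  qed simp
  then show ?thesis by (simp only: fock_weight_def power_add)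
qed

lemma fock_weight_pos: "0 < s \<Longrightarrow> 0 < fock_weight s n"
  by (simp add: fock_weight_def)

lemma fock_weight_nonneg: "0 < s \<Longrightarrow> 0 \<le> fock_weight s n"
  by (simp add: fock_weight_def)

lemma fock_norm_eq:
  assumes "f \<in> fock_space s"
  shows "fock_norm s f = sqrt (\<Sum>n. fock_weight s n * (cmod (f n))\<^sup>2)"
proof -
  have "of_real (fock_weight s n) * (f n * cnj (f n))
      = complex_of_real (fock_weight s n * (cmod (f n))\<^sup>2)" for n
    by (simp flip: complex_norm_square)
  then have "fock_inner s f f = (\<Sum>n. complex_of_real (fock_weight s n * (cmod (f n))\<^sup>2))"
    by (simp only: fock_inner_def)
  also have "\<dots> = of_real (\<Sum>n. fock_weight s n * (cmod (f n))\<^sup>2)"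
    using assms by (simp only: fock_space_def mem_Collect_eq suminf_of_real)
  finally show ?thesis by (simp add: fock_norm_def)
qed

lemma xi_in_fock: "xi n \<in> fock_space s"
  unfolding fock_space_def xi_def
  by (auto intro!: summable_finite[of "{n}"] split: if_splits)

lemma fock_inner_xi:
  "fock_inner s (xi n) (xi m) = (if m = n then of_real (s ^ (n * (n - 1) div 2)) else 0)"
proof -
  have "fock_inner s (xi n) (xi m)
      = (\<Sum>k\<in>{n}. of_real (fock_weight s k) * (xi n k * cnj (xi m k)))"
    unfolding fock_inner_def by (rule suminf_finite) (auto simp: xi_def)
  then show ?thesis by (auto simp: xi_def fock_weight_def)
qed

lemma fock_comb:
  assumes s: "0 < s" and f: "f \<in> fock_space s" and g: "g \<in> fock_space s"
  shows "(\<lambda>n. x * f n + y * g n) \<in> fock_space s"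
proof -
  have le: "(cmod (x * f n + y * g n))\<^sup>2
      \<le> 2 * (cmod x)\<^sup>2 * (cmod (f n))\<^sup>2 + 2 * (cmod y)\<^sup>2 * (cmod (g n))\<^sup>2" for n
  proof -
    have "(cmod (x * f n + y * g n))\<^sup>2 \<le> (cmod (x * f n) + cmod (y * g n))\<^sup>2"
      by (intro power_mono norm_triangle_ineq) auto
    also have "\<dots> \<le> 2 * (cmod (x * f n))\<^sup>2 + 2 * (cmod (y * g n))\<^sup>2"
      using zero_le_power2[of "cmod (x * f n) - cmod (y * g n)"]
      unfolding power2_sum power2_diff by linarith
    finally show ?thesis by (simp add: norm_mult power_mult_distrib)
  qed
  have "summable (\<lambda>n. 2 * (cmod x)\<^sup>2 * (fock_weight s n * (cmod (f n))\<^sup>2)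
      + 2 * (cmod y)\<^sup>2 * (fock_weight s n * (cmod (g n))\<^sup>2))"
    using f g unfolding fock_space_def mem_Collect_eq
    by (intro summable_add summable_mult)
  then show ?thesis unfolding fock_space_def mem_Collect_eq
  proof (rule summable_comparison_test')
    fix n
    show "norm (fock_weight s n * (cmod (x * f n + y * g n))\<^sup>2)
      \<le> 2 * (cmod x)\<^sup>2 * (fock_weight s n * (cmod (f n))\<^sup>2)
      + 2 * (cmod y)\<^sup>2 * (fock_weight s n * (cmod (g n))\<^sup>2)"
      using mult_left_mono[OF le[of n] fock_weight_nonneg[OF s, of n]] fock_weight_nonneg[OF s, of n]
      by (simp add: algebra_simps)
  qed
qed

lemma fock_diff:
  assumes "0 < s" "f \<in> fock_space s" "g \<in> fock_space s"
  shows "(\<lambda>n. f n - g n) \<in> fock_space s"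
  using fock_comb[OF assms, of 1 "-1"] by simp

lemma fock_inner_summable:
  assumes s: "0 < s" and f: "f \<in> fock_space s" and g: "g \<in> fock_space s"
  shows "summable (\<lambda>n. of_real (fock_weight s n) * (f n * cnj (g n)))"
proof (rule summable_norm_cancel, rule summable_comparison_test')
  show "summable (\<lambda>n. fock_weight s n * (cmod (f n))\<^sup>2 + fock_weight s n * (cmod (g n))\<^sup>2)"
    using f g by (auto simp: fock_space_def intro: summable_add)
  fix n
  have "cmod (f n) * cmod (g n) \<le> (cmod (f n))\<^sup>2 + (cmod (g n))\<^sup>2"
    using zero_le_power2[of "cmod (f n) - cmod (g n)"] zero_le_power2[of "cmod (f n)"]
      zero_le_power2[of "cmod (g n)"] unfolding power2_diff by linarith
  from mult_left_mono[OF this fock_weight_nonneg[OF s, of n]]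
  show "norm (norm (of_real (fock_weight s n) * (f n * cnj (g n))))
      \<le> fock_weight s n * (cmod (f n))\<^sup>2 + fock_weight s n * (cmod (g n))\<^sup>2"
    using fock_weight_nonneg[OF s, of n] by (simp add: norm_mult algebra_simps)
qed

lemma fock_sum_le_norm:
  assumes s: "0 < s" and f: "f \<in> fock_space s"
  shows "(\<Sum>k<j. fock_weight s k * (cmod (f k))\<^sup>2) \<le> (fock_norm s f)\<^sup>2"
proof -
  have sm: "summable (\<lambda>n. fock_weight s n * (cmod (f n))\<^sup>2)"
    using f by (simp add: fock_space_def)
  have "0 \<le> (\<Sum>n. fock_weight s n * (cmod (f n))\<^sup>2)"
    by (intro suminf_nonneg[OF sm]) (simp add: fock_weight_nonneg[OF s])
  moreover have "(\<Sum>k<j. fock_weight s k * (cmod (f k))\<^sup>2) \<le> (\<Sum>n. fock_weight s n * (cmod (f n))\<^sup>2)"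
    by (intro sum_le_suminf[OF sm]) (simp_all add: fock_weight_nonneg[OF s])
  ultimately show ?thesis by (simp add: fock_norm_eq[OF f])
qed

lemma fock_norm_leI:
  assumes s: "0 < s" and e: "0 \<le> e"
    and le: "\<And>j. (\<Sum>k<j. fock_weight s k * (cmod (f k))\<^sup>2) \<le> e\<^sup>2"
  shows "f \<in> fock_space s" "fock_norm s f \<le> e"
proof -
  have sm: "summable (\<lambda>n. fock_weight s n * (cmod (f n))\<^sup>2)"
    by (intro summableI_nonneg_bounded[where x = "e\<^sup>2"] le) (simp add: fock_weight_nonneg[OF s])
  then show f: "f \<in> fock_space s" by (simp add: fock_space_def)
  have "(\<Sum>n. fock_weight s n * (cmod (f n))\<^sup>2) \<le> e\<^sup>2"
    by (rule suminf_le_const[OF sm le])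
  then show "fock_norm s f \<le> e"
    unfolding fock_norm_eq[OF f] using e by (intro real_le_lsqrt) auto
qed

lemma fock_complete:
  assumes s: "0 < s" and F: "\<And>n. F n \<in> fock_space s"
    and Cauchy: "\<And>e. 0 < e \<Longrightarrow> \<exists>N. \<forall>m\<ge>N. \<forall>n\<ge>N. fock_norm s (\<lambda>k. F m k - F n k) < e"
  shows "\<exists>f\<in>fock_space s. (\<lambda>n. fock_norm s (\<lambda>k. F n k - f k)) \<longlonglongrightarrow> 0"
proof -
  have D: "(\<lambda>k. F m k - F n k) \<in> fock_space s" for m n
    by (rule fock_diff[OF s F F])
  have "\<exists>l. (\<lambda>n. F n k) \<longlonglongrightarrow> l" for k
  proof -
    have "Cauchy (\<lambda>n. F n k)"
    proof (rule CauchyI)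
      fix e :: real assume e: "0 < e"
      define w where "w = fock_weight s k"
      have w: "0 < w" using fock_weight_pos[OF s] by (simp add: w_def)
      obtain N where N: "\<forall>m\<ge>N. \<forall>n\<ge>N. fock_norm s (\<lambda>k. F m k - F n k) < sqrt w * e"
        using Cauchy[of "sqrt w * e"] e w by auto
      have "norm (F m k - F n k) < e" if "m \<ge> N" "n \<ge> N" for m n
      proof -
        have nn: "0 \<le> fock_norm s (\<lambda>k. F m k - F n k)"
          unfolding fock_norm_eq[OF D] using D[of m n] s
          by (auto simp: fock_space_def fock_weight_nonneg intro!: suminf_nonneg)
        have "w * (cmod (F m k - F n k))\<^sup>2
            \<le> (\<Sum>i<Suc k. fock_weight s i * (cmod (F m i - F n i))\<^sup>2)"
          unfolding w_def by (rule member_le_sum) (auto simp: fock_weight_nonneg[OF s])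
        also have "\<dots> \<le> (fock_norm s (\<lambda>k. F m k - F n k))\<^sup>2"
          by (rule fock_sum_le_norm[OF s D])
        also have "\<dots> < (sqrt w * e)\<^sup>2"
          using N that nn by (intro power_strict_mono) auto
        also have "\<dots> = w * e\<^sup>2" using w by (simp add: power_mult_distrib)
        finally have "(cmod (F m k - F n k))\<^sup>2 < e\<^sup>2" using w by simp
        then show ?thesis using e by (simp add: power_less_imp_less_base)
      qed
      then show "\<exists>M. \<forall>m\<ge>M. \<forall>n\<ge>M. norm (F m k - F n k) < e" by blast
    qed
    then show ?thesis by (simp add: Cauchy_convergent_iff convergent_def)
  qed
  then obtain f where f: "\<And>k. (\<lambda>n. F n k) \<longlonglongrightarrow> f k" by metis
  have key: "\<exists>N. \<forall>n\<ge>N. (\<lambda>k. F n k - f k) \<in> fock_space s \<and> fock_norm s (\<lambda>k. F n k - f k) \<le> e"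
    if e: "0 < e" for e
  proof -
    obtain N where N: "\<forall>m\<ge>N. \<forall>n\<ge>N. fock_norm s (\<lambda>k. F m k - F n k) < e"
      using Cauchy[OF e] by auto
    have "(\<Sum>k<j. fock_weight s k * (cmod (F n k - f k))\<^sup>2) \<le> e\<^sup>2" if n: "n \<ge> N" for n j
    proof (rule LIMSEQ_le_const2)
      show "(\<lambda>m. \<Sum>k<j. fock_weight s k * (cmod (F n k - F m k))\<^sup>2)
          \<longlonglongrightarrow> (\<Sum>k<j. fock_weight s k * (cmod (F n k - f k))\<^sup>2)"
        by (intro tendsto_intros f)
      have "(\<Sum>k<j. fock_weight s k * (cmod (F n k - F m k))\<^sup>2) \<le> e\<^sup>2" if m: "m \<ge> N" for m
      proof -
        have nn: "0 \<le> fock_norm s (\<lambda>k. F n k - F m k)"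
          unfolding fock_norm_eq[OF D] using D[of n m] s
          by (auto simp: fock_space_def fock_weight_nonneg intro!: suminf_nonneg)
        have "(\<Sum>k<j. fock_weight s k * (cmod (F n k - F m k))\<^sup>2)
            \<le> (fock_norm s (\<lambda>k. F n k - F m k))\<^sup>2"
          by (rule fock_sum_le_norm[OF s D])
        also have "\<dots> \<le> e\<^sup>2" using N n m nn by (intro power_mono) (auto intro: less_imp_le)
        finally show ?thesis .
      qed
      then show "\<exists>N. \<forall>m\<ge>N. (\<Sum>k<j. fock_weight s k * (cmod (F n k - F m k))\<^sup>2) \<le> e\<^sup>2" by blast
    qed
    then show ?thesis using fock_norm_leI[OF s, of e] e by (metis less_imp_le)
  qed
  have "f \<in> fock_space s"
  proof -
    obtain N where "(\<lambda>k. F N k - f k) \<in> fock_space s" using key[of 1] by auto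
    from fock_diff[OF s F[of N] this] show ?thesis by simp
  qed
  moreover have "(\<lambda>n. fock_norm s (\<lambda>k. F n k - f k)) \<longlonglongrightarrow> 0"
  proof (rule LIMSEQ_I)
    fix r :: real assume r: "0 < r"
    obtain N where N: "\<forall>n\<ge>N. (\<lambda>k. F n k - f k) \<in> fock_space s \<and> fock_norm s (\<lambda>k. F n k - f k) \<le> r / 2"
      using key[of "r / 2"] r by auto
    have "norm (fock_norm s (\<lambda>k. F n k - f k) - 0) < r" if "n \<ge> N" for n
    proof -
      have m: "(\<lambda>k. F n k - f k) \<in> fock_space s" using N that by blast
      have "0 \<le> fock_norm s (\<lambda>k. F n k - f k)"
        unfolding fock_norm_eq[OF m] using m s
        by (auto simp: fock_space_def fock_weight_nonneg intro!: suminf_nonneg)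
      moreover have "fock_norm s (\<lambda>k. F n k - f k) \<le> r / 2" using N that by blast
      ultimately show ?thesis using r by simp
    qed
    then show "\<exists>no. \<forall>n\<ge>no. norm (fock_norm s (\<lambda>k. F n k - f k) - 0) < r" by blast
  qed
  ultimately show ?thesis by blast
qed

lemma fock_dense:
  assumes s: "0 < s" and f: "f \<in> fock_space s"
  shows "(\<lambda>N. fock_norm s (\<lambda>k. f k - (\<Sum>n<N. f n * xi n k))) \<longlonglongrightarrow> 0"
proof -
  let ?a = "\<lambda>n. fock_weight s n * (cmod (f n))\<^sup>2"
  have sm: "summable ?a" using f by (simp add: fock_space_def)
  have tr: "f k - (\<Sum>n<N. f n * xi n k) = (if k < N then 0 else f k)" for k N
    by (simp add: xi_def if_distrib cong: if_cong)
  have nrm: "fock_norm s (\<lambda>k. f k - (\<Sum>n<N. f n * xi n k)) = sqrt (\<Sum>n. ?a (n + N))" for N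
  proof -
    have sh: "(\<lambda>n. fock_weight s (n + N) * (cmod (if n + N < N then 0 else f (n + N)))\<^sup>2)
        = (\<lambda>n. ?a (n + N))" by simp
    have sm': "summable (\<lambda>k. fock_weight s k * (cmod (if k < N then 0 else f k))\<^sup>2)"
      by (subst summable_iff_shift[of _ N, symmetric]) (use sm in \<open>simp add: summable_iff_shift[of ?a]\<close>)
    then have mem: "(\<lambda>k. if k < N then 0 else f k) \<in> fock_space s" by (simp add: fock_space_def)
    show ?thesis
      unfolding tr fock_norm_eq[OF mem] suminf_split_initial_segment[OF sm', of N] sh
      by simp
  qed
  have "(\<lambda>N. \<Sum>n. ?a (n + N)) \<longlonglongrightarrow> 0"
    by (rule suminf_exist_split2[OF sm])
  then have "(\<lambda>N. sqrt (\<Sum>n. ?a (n + N))) \<longlonglongrightarrow> sqrt 0"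
    by (rule tendsto_real_sqrt)
  then show ?thesis by (simp add: nrm)
qed


section \<open>Basic facts about the operators\<close>

lemma creation_xi: "creation (xi m) = xi (m + 1)"
  by (auto simp: creation_def xi_def fun_eq_iff)

lemma annihilation_xi_0: "annihilation s (xi 0) = (\<lambda>_. 0)"
  by (auto simp: annihilation_def xi_def fun_eq_iff)

lemma annihilation_xi:
  "1 \<le> m \<Longrightarrow> annihilation s (xi m) = (\<lambda>k. of_real (s ^ (m - 1)) * xi (m - 1) k)"
  by (auto simp: annihilation_def xi_def fun_eq_iff)

lemma scalar_op_xi: "scalar_op s (xi m) = (\<lambda>k. of_real (s ^ m) * xi m k)"
  by (auto simp: scalar_op_def xi_def fun_eq_iff)

lemma intermediate_op_xi_0: "intermediate_op t (xi 0) = (\<lambda>_. 0)"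
  by (auto simp: intermediate_op_def xi_def fun_eq_iff)

lemma intermediate_op_xi:
  "1 \<le> m \<Longrightarrow> intermediate_op t (xi m) = (\<lambda>k. of_real (t ^ (m - 1)) * xi m k)"
  by (auto simp: intermediate_op_def xi_def fun_eq_iff)

lemma fock_norm_nonneg: "0 < s \<Longrightarrow> f \<in> fock_space s \<Longrightarrow> 0 \<le> fock_norm s f"
  unfolding fock_norm_eq
  by (auto simp: fock_space_def fock_weight_nonneg intro!: suminf_nonneg)

lemma fock_contractionI:
  assumes s: "0 < s" and f: "f \<in> fock_space s"
    and le: "\<And>n. fock_weight s n * (cmod (g n))\<^sup>2 \<le> fock_weight s n * (cmod (f n))\<^sup>2"
  shows "g \<in> fock_space s \<and> fock_norm s g \<le> fock_norm s f"
proof -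
  have "(\<Sum>k<j. fock_weight s k * (cmod (g k))\<^sup>2) \<le> (fock_norm s f)\<^sup>2" for j
    using sum_mono[of "{..<j}", OF le] fock_sum_le_norm[OF s f, of j] by (rule order_trans)
  with fock_norm_leI[OF s fock_norm_nonneg[OF s f]] show ?thesis by blast
qed

lemma creation_contraction:
  assumes s: "0 < s" "s \<le> 1" and f: "f \<in> fock_space s"
  shows "creation f \<in> fock_space s \<and> fock_norm s (creation f) \<le> fock_norm s f"
proof -
  have "(\<Sum>k<j. fock_weight s k * (cmod (creation f k))\<^sup>2) \<le> (fock_norm s f)\<^sup>2" for j
  proof (cases j)
    case (Suc i)
    have "(\<Sum>k<j. fock_weight s k * (cmod (creation f k))\<^sup>2)
        = (\<Sum>k<i. s ^ k * (fock_weight s k * (cmod (f k))\<^sup>2))"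
      unfolding Suc sum.lessThan_Suc_shift by (simp add: creation_def fock_weight_Suc mult.assoc)
    also have "\<dots> \<le> (\<Sum>k<i. fock_weight s k * (cmod (f k))\<^sup>2)"
      using s by (intro sum_mono mult_left_le_one_le) (auto simp: fock_weight_nonneg power_le_one)
    also have "\<dots> \<le> (fock_norm s f)\<^sup>2" by (rule fock_sum_le_norm[OF s(1) f])
    finally show ?thesis .
  qed simp
  with fock_norm_leI[OF s(1) fock_norm_nonneg[OF s(1) f]] show ?thesis by blast
qed

lemma annihilation_contraction:
  assumes s: "0 < s" "s \<le> 1" and f: "f \<in> fock_space s"
  shows "annihilation s f \<in> fock_space s \<and> fock_norm s (annihilation s f) \<le> fock_norm s f"
proof -
  have "(\<Sum>k<j. fock_weight s k * (cmod (annihilation s f k))\<^sup>2) \<le> (fock_norm s f)\<^sup>2" for j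
  proof -
    have "(\<Sum>k<j. fock_weight s k * (cmod (annihilation s f k))\<^sup>2)
        = (\<Sum>k<j. s ^ k * (fock_weight s (Suc k) * (cmod (f (Suc k)))\<^sup>2))"
      using s(1) by (simp add: annihilation_def fock_weight_Suc norm_mult norm_power power2_eq_square
          algebra_simps)
    also have "\<dots> \<le> (\<Sum>k<j. fock_weight s (Suc k) * (cmod (f (Suc k)))\<^sup>2)"
      using s by (intro sum_mono mult_left_le_one_le) (auto simp: fock_weight_nonneg power_le_one)
    also have "\<dots> \<le> (\<Sum>k<Suc j. fock_weight s k * (cmod (f k))\<^sup>2)"
      unfolding sum.lessThan_Suc_shift by simp
    also have "\<dots> \<le> (fock_norm s f)\<^sup>2" by (rule fock_sum_le_norm[OF s(1) f])
    finally show ?thesis .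
  qed
  with fock_norm_leI[OF s(1) fock_norm_nonneg[OF s(1) f]] show ?thesis by blast
qed

lemma diagonal_contraction:
  assumes s: "0 < s" and f: "f \<in> fock_space s" and d: "\<And>n. \<bar>d n\<bar> \<le> 1"
  shows "(\<lambda>n. of_real (d n) * f n) \<in> fock_space s
    \<and> fock_norm s (\<lambda>n. of_real (d n) * f n) \<le> fock_norm s f"
proof (rule fock_contractionI[OF s f])
  fix n
  have "(cmod (of_real (d n) * f n))\<^sup>2 \<le> (cmod (f n))\<^sup>2"
    using d[of n] by (intro power_mono) (auto simp: norm_mult intro: mult_left_le_one_le)
  then show "fock_weight s n * (cmod (of_real (d n) * f n))\<^sup>2 \<le> fock_weight s n * (cmod (f n))\<^sup>2"
    by (intro mult_left_mono fock_weight_nonneg[OF s])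
qed

lemma scalar_op_contraction:
  assumes "0 < s" "s \<le> 1" "f \<in> fock_space s"
  shows "scalar_op s f \<in> fock_space s \<and> fock_norm s (scalar_op s f) \<le> fock_norm s f"
  unfolding scalar_op_def
  by (rule diagonal_contraction) (use assms in \<open>auto simp: power_le_one\<close>)

lemma intermediate_op_eq:
  "intermediate_op t f = (\<lambda>n. of_real (if n = 0 then 0 else t ^ (n - 1)) * f n)"
  by (auto simp: intermediate_op_def)

lemma intermediate_op_contraction:
  assumes "0 < s" "0 < t" "t \<le> 1" "f \<in> fock_space s"
  shows "intermediate_op t f \<in> fock_space s \<and> fock_norm s (intermediate_op t f) \<le> fock_norm s f"
  unfolding intermediate_op_eq
  by (rule diagonal_contraction) (use assms in \<open>auto simp: power_le_one\<close>)

lemma fock_norm_comb: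
  assumes s: "0 < s" and f: "f \<in> fock_space s" and g: "g \<in> fock_space s"
  shows "fock_norm s (\<lambda>n. x * f n + y * g n) \<le> cmod x * fock_norm s f + cmod y * fock_norm s g"
proof (rule fock_norm_leI(2)[OF s])
  show "0 \<le> cmod x * fock_norm s f + cmod y * fock_norm s g"
    using fock_norm_nonneg[OF s] f g by simp
  fix j
  let ?w = "\<lambda>n. sqrt (fock_weight s n)"
  have L2: "(\<Sum>k<j. fock_weight s k * (cmod (h k))\<^sup>2) = (L2_set (\<lambda>k. ?w k * cmod (h k)) {..<j})\<^sup>2" for h
    by (simp add: L2_set_def sum_nonneg fock_weight_nonneg[OF s] power_mult_distrib)
  have bd: "L2_set (\<lambda>k. ?w k * cmod (h k)) {..<j} \<le> fock_norm s h" if "h \<in> fock_space s" for h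
    using fock_sum_le_norm[OF s that, of j] fock_norm_nonneg[OF s that]
    unfolding L2 by (rule power2_le_imp_le)
  have "L2_set (\<lambda>k. ?w k * cmod (x * f k + y * g k)) {..<j}
      \<le> L2_set (\<lambda>k. cmod x * (?w k * cmod (f k)) + cmod y * (?w k * cmod (g k))) {..<j}"
  proof (rule L2_set_mono)
    fix k
    have "?w k * cmod (x * f k + y * g k) \<le> ?w k * (cmod (x * f k) + cmod (y * g k))"
      by (intro mult_left_mono norm_triangle_ineq) (simp add: fock_weight_nonneg[OF s])
    then show "?w k * cmod (x * f k + y * g k)
        \<le> cmod x * (?w k * cmod (f k)) + cmod y * (?w k * cmod (g k))"
      by (simp add: norm_mult algebra_simps)
  qed (simp add: fock_weight_nonneg[OF s])
  also have "\<dots> \<le> L2_set (\<lambda>k. cmod x * (?w k * cmod (f k))) {..<j}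
      + L2_set (\<lambda>k. cmod y * (?w k * cmod (g k))) {..<j}"
    by (rule L2_set_triangle_ineq)
  also have "\<dots> = cmod x * L2_set (\<lambda>k. ?w k * cmod (f k)) {..<j}
      + cmod y * L2_set (\<lambda>k. ?w k * cmod (g k)) {..<j}"
    by (simp add: L2_set_right_distrib)
  also have "\<dots> \<le> cmod x * fock_norm s f + cmod y * fock_norm s g"
    by (intro add_mono mult_left_mono bd f g) auto
  finally show "(\<Sum>k<j. fock_weight s k * (cmod (x * f k + y * g k))\<^sup>2)
      \<le> (cmod x * fock_norm s f + cmod y * fock_norm s g)\<^sup>2"
    unfolding L2 by (intro power_mono) (auto simp: L2_set_nonneg)
qed

lemma annihilation_adjoint_creation:
  assumes s: "0 < s" "s \<le> 1"
  shows "fock_adjoint s creation (annihilation s)"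
  unfolding fock_adjoint_def
proof (intro ballI)
  fix f g assume f: "f \<in> fock_space s" and g: "g \<in> fock_space s"
  have "creation f \<in> fock_space s" using creation_contraction[OF s f] by blast
  from fock_inner_summable[OF s(1) this g]
  have "fock_inner s (creation f) g
      = (\<Sum>n. of_real (fock_weight s (Suc n)) * (creation f (Suc n) * cnj (g (Suc n))))"
    unfolding fock_inner_def by (subst suminf_split_head) (auto simp: creation_def)
  also have "\<dots> = fock_inner s f (annihilation s g)"
    unfolding fock_inner_def
    by (simp add: creation_def annihilation_def fock_weight_Suc algebra_simps)
  finally show "fock_inner s (creation f) g = fock_inner s f (annihilation s g)" .
qed

lemma fock_inner_comb_left:
  assumes "0 < s" "f \<in> fock_space s" "g \<in> fock_space s" "h \<in> fock_space s"
  shows "fock_inner s (\<lambda>n. x * f n + y * g n) h = x * fock_inner s f h + y * fock_inner s g h"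
proof -
  note sf = fock_inner_summable[OF assms(1,2,4)] and sg = fock_inner_summable[OF assms(1,3,4)]
  have "(\<lambda>n. of_real (fock_weight s n) * ((x * f n + y * g n) * cnj (h n)))
      sums (x * fock_inner s f h + y * fock_inner s g h)"
    using sums_add[OF sums_mult[OF summable_sums[OF sf], of x]
        sums_mult[OF summable_sums[OF sg], of y]]
    by (simp add: fock_inner_def algebra_simps)
  then show ?thesis unfolding fock_inner_def by (simp add: sums_iff)
qed

lemma fock_inner_cnj:
  assumes "0 < s" "f \<in> fock_space s" "g \<in> fock_space s"
  shows "fock_inner s g f = cnj (fock_inner s f g)"
proof -
  have "(\<lambda>n. cnj (of_real (fock_weight s n) * (f n * cnj (g n)))) sums cnj (fock_inner s f g)"
    unfolding fock_inner_def sums_cnj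
    by (rule summable_sums[OF fock_inner_summable[OF assms]])
  then show ?thesis unfolding fock_inner_def by (simp add: sums_iff mult.commute)
qed

lemma free_poisson_op_eq:
  "free_poisson_op s t l f = (\<lambda>n.
     1 * (1 * intermediate_op t f n
          + of_real (sqrt l) * (1 * creation f n + 1 * annihilation s f n))
     + of_real l * scalar_op s f n)"
  by (simp add: free_poisson_op_def)

lemma free_poisson_op_bounded:
  assumes s: "0 < s" "s \<le> 1" and t: "0 < t" "t \<le> 1" and l: "0 < l"
  shows "fock_bounded_op s (free_poisson_op s t l)"
  unfolding fock_bounded_op_def
proof (intro conjI ballI allI exI)
  fix f g and x y :: complex
  show "free_poisson_op s t l (\<lambda>n. x * f n + y * g n)
      = (\<lambda>n. x * free_poisson_op s t l f n + y * free_poisson_op s t l g n)"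
    by (simp add: free_poisson_op_def intermediate_op_def creation_def annihilation_def
        scalar_op_def fun_eq_iff algebra_simps)
next
  fix f assume f: "f \<in> fock_space s"
  note c = creation_contraction[OF s f] and a = annihilation_contraction[OF s f]
    and k = scalar_op_contraction[OF s f] and m = intermediate_op_contraction[OF s(1) t f]
  let ?ca = "\<lambda>n. 1 * creation f n + 1 * annihilation s f n"
  let ?mca = "\<lambda>n. 1 * intermediate_op t f n + of_real (sqrt l) * ?ca n"
  have ca: "?ca \<in> fock_space s" using fock_comb[OF s(1)] c a by blast
  have mca: "?mca \<in> fock_space s" using fock_comb[OF s(1)] m ca by blast
  show "free_poisson_op s t l f \<in> fock_space s"
    unfolding free_poisson_op_eq using fock_comb[OF s(1) mca] k by blast
  have "fock_norm s (free_poisson_op s t l f) \<le> fock_norm s ?mca + l * fock_norm s (scalar_op s f)"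
    unfolding free_poisson_op_eq
    using fock_norm_comb[OF s(1) mca, of "scalar_op s f" 1 "of_real l"] k l by simp
  moreover have "fock_norm s ?mca
      \<le> fock_norm s (intermediate_op t f) + sqrt l * fock_norm s ?ca"
    using fock_norm_comb[OF s(1) _ ca, of "intermediate_op t f" 1 "of_real (sqrt l)"] m l by simp
  moreover have "fock_norm s ?ca \<le> fock_norm s (creation f) + fock_norm s (annihilation s f)"
    using fock_norm_comb[OF s(1), of "creation f" "annihilation s f" 1 1] c a by simp
  then have "sqrt l * fock_norm s ?ca \<le> sqrt l * (2 * fock_norm s f)"
    using c a l by (intro mult_left_mono) auto
  moreover have "l * fock_norm s (scalar_op s f) \<le> l * fock_norm s f"
    using k l by (intro mult_left_mono) auto
  ultimately show "fock_norm s (free_poisson_op s t l f) \<le> (1 + 2 * sqrt l + l) * fock_norm s f"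
    using m by (simp add: algebra_simps)
qed

lemma free_poisson_op_selfadjoint:
  assumes s: "0 < s" "s \<le> 1" and t: "0 < t" "t \<le> 1"
  shows "fock_adjoint s (free_poisson_op s t l) (free_poisson_op s t l)"
  unfolding fock_adjoint_def
proof (intro ballI)
  have exp: "fock_inner s (free_poisson_op s t l f) g
      = fock_inner s (intermediate_op t f) g
        + of_real (sqrt l) * (fock_inner s (creation f) g + fock_inner s (annihilation s f) g)
        + of_real l * fock_inner s (scalar_op s f) g"
    if f: "f \<in> fock_space s" and g: "g \<in> fock_space s" for f g
  proof -
    note c = creation_contraction[OF s f] and a = annihilation_contraction[OF s f]
      and k = scalar_op_contraction[OF s f] and m = intermediate_op_contraction[OF s(1) t f]
    let ?ca = "\<lambda>n. 1 * creation f n + 1 * annihilation s f n"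
    let ?mca = "\<lambda>n. 1 * intermediate_op t f n + of_real (sqrt l) * ?ca n"
    have ca: "?ca \<in> fock_space s" using fock_comb[OF s(1)] c a by blast
    have mca: "?mca \<in> fock_space s" using fock_comb[OF s(1)] m ca by blast
    show ?thesis unfolding free_poisson_op_eq
      using fock_inner_comb_left[OF s(1) mca _ g, of "scalar_op s f" 1 "of_real l"]
        fock_inner_comb_left[OF s(1) _ ca g, of "intermediate_op t f" 1 "of_real (sqrt l)"]
        fock_inner_comb_left[OF s(1) _ _ g, of "creation f" "annihilation s f" 1 1] c a k m
      by simp
  qed
  fix f g assume f: "f \<in> fock_space s" and g: "g \<in> fock_space s"
  note c = creation_contraction[OF s] and a = annihilation_contraction[OF s]
  note adj = annihilation_adjoint_creation[OF s, unfolded fock_adjoint_def, rule_format]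
  have P: "free_poisson_op s t l h \<in> fock_space s" if h: "h \<in> fock_space s" for h
    unfolding free_poisson_op_eq
    by (intro fock_comb[OF s(1)] conjunct1[OF creation_contraction[OF s h]]
        conjunct1[OF annihilation_contraction[OF s h]] conjunct1[OF scalar_op_contraction[OF s h]]
        conjunct1[OF intermediate_op_contraction[OF s(1) t h]])
  have 1: "fock_inner s (intermediate_op t f) g = cnj (fock_inner s (intermediate_op t g) f)"
    using intermediate_op_contraction[OF s(1) t g]
    by (subst fock_inner_cnj[OF s(1) _ f, symmetric])
      (auto simp: fock_inner_def intermediate_op_eq mult_ac intro!: suminf_cong)
  have 2: "fock_inner s (scalar_op s f) g = cnj (fock_inner s (scalar_op s g) f)"
    using scalar_op_contraction[OF s g]
    by (subst fock_inner_cnj[OF s(1) _ f, symmetric])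
      (auto simp: fock_inner_def scalar_op_def mult_ac)
  have 3: "fock_inner s (creation f) g = cnj (fock_inner s (annihilation s g) f)"
    using adj[OF f g] fock_inner_cnj[OF s(1), of "annihilation s g" f] a[OF g] f by simp
  have 4: "fock_inner s (annihilation s f) g = cnj (fock_inner s (creation g) f)"
    using adj[OF g f] fock_inner_cnj[OF s(1), of g "annihilation s f"] a[OF f] g by simp
  have "fock_inner s (free_poisson_op s t l f) g = cnj (fock_inner s (free_poisson_op s t l g) f)"
    unfolding exp[OF f g] exp[OF g f] 1 2 3 4 by (simp add: algebra_simps)
  also have "\<dots> = fock_inner s f (free_poisson_op s t l g)"
    using fock_inner_cnj[OF s(1) P[OF g] f] by simp
  finally show "fock_inner s (free_poisson_op s t l f) g = fock_inner s f (free_poisson_op s t l g)" .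
qed

end

theory Submission
  imports Defs
begin

text \<open>
  Pairing the \<open>k\<close>-th power of \<open>P = free_poisson_op s t l\<close> applied to the vacuum with
  \<open>l\<^bsup>m/2\<^esup> \<cdot> xi m\<close> gives a multiple of its \<open>m\<close>-th coefficient. The three-term action of \<open>P\<close> on coefficients
  matches the recursion of the polynomials \<open>C\<^sub>m\<close>, so the pairing equals the integral of \<open>x\<^sup>k C\<^sub>m\<close>.
  As \<open>P\<close> enlarges the support of a coefficient sequence by at most one step, the pairing vanishes
  for \<open>k < m\<close>; hence \<open>C\<^sub>m\<close> is orthogonal to all polynomials of degree less than \<open>m\<close>.
\<close>

text \<open>Compactness bounds \<open>f\<close> on \<open>K\<close>, which carries all the mass, so
  \<open>f\<close> is almost everywhere bounded under a finite measure.\<close>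

lemma integrable_continuous_compact_support:
  fixes f :: "'a::t2_space \<Rightarrow> real"
  assumes M: "finite_measure M"
    and sets: "sets M = sets borel" and K: "compact K" "emeasure M (- K) = 0"
    and f: "continuous_on UNIV f"
  shows "integrable M f"
proof -
  have "bounded (f ` K)"
    by (intro compact_imp_bounded compact_continuous_image continuous_on_subset[OF f] K(1)) simp
  then obtain B where B: "\<And>x. x \<in> K \<Longrightarrow> norm (f x) \<le> B"
    by (auto simp: bounded_iff)
  \<comment> \<open>\<open>emeasure\<close> defaults to 0 on non-measurable sets, so
    \<open>K(2)\<close> alone does not make \<open>- K\<close> a null set.\<close>
  have "- K \<in> sets M"
    using K(1) by (simp add: sets compact_imp_closed)
  then have "- K \<in> null_sets M"
    using K(2) by (simp add: null_sets_def)
  then have "AE x in M. x \<notin> - K" by (rule AE_not_in)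
  then have "AE x in M. norm (f x) \<le> B" by eventually_elim (use B in simp)
  moreover have "f \<in> borel_measurable M"
    unfolding measurable_cong_sets[OF sets refl] by (rule borel_measurable_continuous_onI[OF f])
  ultimately show ?thesis by (rule finite_measure.integrable_const_bound[OF M])
qed

text \<open>Supplies the integrability that splitting integrals by linearity requires below.\<close>

lemma vacuum_distribution_integrable_poly:
  assumes "vacuum_distribution s b \<mu>"
  shows "integrable \<mu> (\<lambda>x. x ^ k * poly p x)"
proof -
  from assms obtain K where "prob_space \<mu>"
    and K: "sets \<mu> = sets borel" "compact K" "emeasure \<mu> (- K) = 0"
    unfolding vacuum_distribution_def by blast
  have "continuous_on UNIV (\<lambda>x. x ^ k * poly p x)"
    by (intro continuous_intros)
  with prob_space.finite_measure[OF \<open>prob_space \<mu>\<close>] K show ?thesis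
    by (rule integrable_continuous_compact_support)
qed

lemma fock_inner_vacuum: "fock_inner s f vacuum = f 0"
proof -
  have "fock_inner s f vacuum = (\<Sum>k\<in>{0}. of_real (fock_weight s k) * (f k * cnj (vacuum k)))"
    unfolding fock_inner_def by (rule suminf_finite) (auto simp: xi_def)
  then show ?thesis by (simp add: xi_def)
qed

text \<open>Index 0 is separate because \<open>creation f\<close> and
  \<open>intermediate_op t f\<close> vanish there.\<close>

lemma free_poisson_op_0:
  "free_poisson_op s t l f 0 = of_real (sqrt l) * f 1 + of_real l * f 0"
  by (simp add: free_poisson_op_def intermediate_op_def creation_def annihilation_def scalar_op_def)

text \<open>The coefficient of \<open>f (Suc m)\<close> is the one subtracted from x in the
  recursion for \<open>charlier_poly s t l (Suc (Suc m))\<close>.\<close>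

lemma free_poisson_op_Suc:
  "free_poisson_op s t l f (Suc m) = of_real (l * s ^ Suc m + t ^ m) * f (Suc m)
     + of_real (sqrt l) * (f m + of_real (s ^ Suc m) * f (Suc (Suc m)))"
  by (simp add: free_poisson_op_def intermediate_op_def creation_def annihilation_def scalar_op_def
      algebra_simps)

lemma free_poisson_op_power_vacuum_eq_0:
  "k < m \<Longrightarrow> (free_poisson_op s t l ^^ k) vacuum m = 0"
proof (induction k arbitrary: m)
  case 0
  then show ?case by (simp add: xi_def)
next
  case (Suc k)
  then obtain j where "m = Suc j" "k < j" by (cases m) auto
  \<comment> \<open>The new coefficient at \<open>Suc j\<close> involves only the old ones at
    \<open>j\<close>, \<open>Suc j\<close> and \<open>Suc (Suc j)\<close>, all beyond
    \<open>k\<close>.\<close>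
  then show ?case by (simp add: free_poisson_op_Suc Suc.IH)
qed

lemma degree_charlier_poly_le: "degree (charlier_poly s t l n) \<le> n"
proof (induction s t l n rule: charlier_poly.induct)
  case (3 s t l k)
  have "degree ([:- (l * s ^ Suc k + t ^ k), 1:] * charlier_poly s t l (Suc k)) \<le> 1 + Suc k"
    by (rule order.trans[OF degree_mult_le add_mono[OF _ 3(1)]]) simp
  moreover have "degree (smult (l * s ^ k) (charlier_poly s t l k)) \<le> Suc (Suc k)"
    by (rule order.trans[OF degree_smult_le]) (use 3(2) in linarith)
  ultimately show ?case
    unfolding charlier_poly.simps by (intro degree_diff_le) simp_all
qed simp_all

text \<open>The factor \<open>c m = sqrt l ^ m * fock_weight s m\<close> satisfies
  \<open>c (Suc m) = sqrt l * s ^ m * c m\<close>. It thus absorbs the annihilation coefficient, as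
  fits a monic recursion.\<close>

lemma free_poisson_moment_charlier_poly:
  assumes l: "l > 0" and \<mu>: "vacuum_distribution s (free_poisson_op s t l) \<mu>"
  shows "of_real (sqrt l ^ m * fock_weight s m) * (free_poisson_op s t l ^^ k) vacuum m
    = of_real (\<integral>x. x ^ k * poly (charlier_poly s t l m) x \<partial>\<mu>)"
\<comment> \<open>The recursion reaches back two indices, and its factor x turns \<open>k\<close>
  into \<open>Suc k\<close>, that is, one more application of the operator.\<close>
proof (induction m arbitrary: k rule: less_induct)
  case (less m)
  let ?P = "free_poisson_op s t l" and ?C = "charlier_poly s t l"
  let ?I = "\<lambda>k m. \<integral>x. x ^ k * poly (?C m) x \<partial>\<mu>"
  let ?u = "\<lambda>k m. of_real (sqrt l ^ m * fock_weight s m) * (?P ^^ k) vacuum m"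
  note int = vacuum_distribution_integrable_poly[OF \<mu>]
  have IH: "of_real (?I i j) = ?u i j" if "j < m" for i j
    using less[OF that] by simp
  consider "m = 0" | "m = 1" | j where "m = Suc (Suc j)"
    by (metis One_nat_def old.nat.exhaust)
  then show ?case
  proof cases
    case 1
    \<comment> \<open>For \<open>m = 0\<close> this is the moment condition defining the
      distribution.\<close>
    then show ?thesis
      using \<mu> by (simp add: vacuum_distribution_def vacuum_expectation_def fock_inner_vacuum)
  next
    case 2
    have "?I k 1 = (\<integral>x. x ^ Suc k * poly (?C 0) x - l * (x ^ k * poly (?C 0) x) \<partial>\<mu>)"
      by (simp add: algebra_simps)
    also have "\<dots> = ?I (Suc k) 0 - l * ?I k 0"
      by (simp only: Bochner_Integration.integral_diff int integrable_mult_right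
          integral_mult_right_zero)
    finally have "of_real (?I k 1) = ?u (Suc k) 0 - of_real l * ?u k 0"
      using 2 by (simp only: of_real_diff of_real_mult IH)
    also have "\<dots> = ?u k 1"
      by (simp add: free_poisson_op_0 fock_weight_Suc)
    finally show ?thesis using 2 by simp
  next
    case (3 j)
    then have j: "Suc j < m" "j < m" by simp_all
    let ?b = "l * s ^ Suc j + t ^ j"
    have "?I k m = (\<integral>x. x ^ Suc k * poly (?C (Suc j)) x - ?b * (x ^ k * poly (?C (Suc j)) x)
        - l * s ^ j * (x ^ k * poly (?C j) x) \<partial>\<mu>)"
      unfolding 3 by (intro Bochner_Integration.integral_cong refl) (simp add: algebra_simps)
    also have "\<dots> = ?I (Suc k) (Suc j) - ?b * ?I k (Suc j) - l * s ^ j * ?I k j"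
      by (simp only: Bochner_Integration.integral_diff Bochner_Integration.integrable_diff
          int integrable_mult_right integral_mult_right_zero)
    finally have "of_real (?I k m)
        = ?u (Suc k) (Suc j) - of_real ?b * ?u k (Suc j) - of_real (l * s ^ j) * ?u k j"
      by (simp only: of_real_diff of_real_mult[of ?b] of_real_mult[of "l * s ^ j"]
          IH[OF j(1)] IH[OF j(2)])
    also have "\<dots> = ?u k m"
    proof -
      \<comment> \<open>The creation coefficient \<open>sqrt l\<close> must match
        \<open>l * s ^ j\<close> in the recursion: one \<open>sqrt l\<close> and
        \<open>s ^ j\<close> come from the change of factor from \<open>j\<close> to
        \<open>Suc j\<close>. Here \<open>l > 0\<close> gives
        \<open>sqrt l * sqrt l = l\<close>.\<close>
      have "l * s ^ j * (sqrt l ^ j * fock_weight s j)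
          = (sqrt l * sqrt l) * s ^ j * (sqrt l ^ j * fock_weight s j)"
        using l by simp
      also have "\<dots> = sqrt l ^ Suc j * fock_weight s (Suc j) * sqrt l"
        by (simp only: fock_weight_Suc power_Suc mult_ac)
      finally have eq: "of_real (l * s ^ j) * ?u k j
          = of_real (sqrt l ^ Suc j * fock_weight s (Suc j)) * (of_real (sqrt l) * (?P ^^ k) vacuum j)"
        by (simp only: of_real_mult[symmetric] mult.assoc[symmetric])
      show ?thesis
        unfolding 3 eq funpow.simps o_apply free_poisson_op_Suc fock_weight_Suc[of s "Suc j"]
        by (simp add: algebra_simps)
    qed
    finally show ?thesis by simp
  qed
qed

lemma integral_charlier_poly_lower_degree:
  assumes l: "l > 0" and \<mu>: "vacuum_distribution s (free_poisson_op s t l) \<mu>"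
    and p: "degree p < m"
  shows "(\<integral>x. poly p x * poly (charlier_poly s t l m) x \<partial>\<mu>) = 0"
proof -
  let ?C = "charlier_poly s t l m"
  have "(\<integral>x. poly p x * poly ?C x \<partial>\<mu>)
      = (\<integral>x. (\<Sum>k\<le>degree p. coeff p k * (x ^ k * poly ?C x)) \<partial>\<mu>)"
    by (simp only: poly_altdef sum_distrib_right mult.assoc)
  also have "\<dots> = (\<Sum>k\<le>degree p. coeff p k * (\<integral>x. x ^ k * poly ?C x \<partial>\<mu>))"
    by (simp add: Bochner_Integration.integral_sum vacuum_distribution_integrable_poly[OF \<mu>])
  also have "\<dots> = 0"
  proof (intro sum.neutral ballI)
    fix k assume "k \<in> {..degree p}"
    with p have "k < m" by simp
    \<comment> \<open>The integral is real, but the coefficient that it equals is complex.\<close>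
    then have "complex_of_real (\<integral>x. x ^ k * poly ?C x \<partial>\<mu>) = 0"
      unfolding free_poisson_moment_charlier_poly[OF l \<mu>, symmetric]
      by (simp add: free_poisson_op_power_vacuum_eq_0)
    then show "coeff p k * (\<integral>x. x ^ k * poly ?C x \<partial>\<mu>) = 0" by simp
  qed
  finally show ?thesis .
qed

theorem theorem3p4:
  fixes s t l :: real and \<mu> :: "real measure" and m n :: nat
  assumes "l > 0"
    and "0 < s" and "s \<le> 1"
    and "0 < t" and "t \<le> 1"
    and "vacuum_distribution s (free_poisson_op s t l) \<mu>"
    and "m \<noteq> n"
  shows "(\<integral>x. poly (charlier_poly s t l n) x * poly (charlier_poly s t l m) x \<partial>\<mu>) = 0"
proof -
  \<comment> \<open>The polynomial of smaller index serves as \<open>p\<close>; an upper bound on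
    its degree suffices.\<close>
  note orth = integral_charlier_poly_lower_degree[OF \<open>l > 0\<close> assms(6)
      le_less_trans[OF degree_charlier_poly_le]]
  from \<open>m \<noteq> n\<close> consider "n < m" | "m < n" by linarith
  then show ?thesis
  proof cases
    case 1
    then show ?thesis by (rule orth)
  next
    case 2
    from orth[OF 2] show ?thesis by (simp only: mult.commute)
  qed
qed

end
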